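(* Let $k$ be a field, let $n\ge 1$, and let $Q=\overrightarrow{\mathbb{A}_n}$ be the linear quiver with vertices $1,\dots,n$ and arrows $\alpha_i:i\to i+1$ for $1\le i\le n-1$. The path algebra $A=kQ$, with $k$-basis $e_1,\dots,e_n$ and $\alpha_i\alpha_{i+1}\cdots\alpha_j$ for $1\le i\le j\le n-1$, admits only one independent nearly Frobenius structure (that is, the space of nearly Frobenius coproducts on $A$ is one-dimensional), spanned by the coproduct $\Delta$ defined by $$\Delta(e_1)=\alpha_1\cdots\alpha_{n-1}\otimes e_1,\qquad \Delta(e_n)=e_n\otimes\alpha_1\cdots\alpha_{n-1},$$ $$\Delta(e_i)=\alpha_i\cdots\alpha_{n-1}\otimes\alpha_1\cdots\alpha_{i-1}\quad(i=2,\dots,n-1),$$ $$\Delta(\alpha_i\cdots\alpha_j)=\alpha_i\cdots\alpha_{n-1}\otimes\alpha_1\cdots\alpha_j\quad(1\le i\le j\le n-1).$$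
   Context: Path algebra conventions: $kQ$ has as basis all paths of $Q$ including the trivial paths $e_i$ at the vertices; a path $\alpha_1\cdots\alpha_l$ satisfies $t(\alpha_k)=s(\alpha_{k+1})$ (paths are composed left to right), and the product of two paths is their concatenation if the target of the first is the source of the second and $0$ otherwise. For $n=1$ the empty product $\alpha_1\cdots\alpha_{n-1}$ is read as $e_1$. A nearly Frobenius coproduct (structure) on a $k$-algebra $A$ with multiplication $m$ is a $k$-linear map $\Delta:A\to A\otimes_k A$ such that $(\Delta\otimes 1)\circ\Delta=(1\otimes\Delta)\circ\Delta$ and $\Delta$ is an $A$-bimodule morphism: $\Delta\circ m=(1\otimes m)\circ(\Delta\otimes 1)=(m\otimes 1)\circ(1\otimes\Delta)$. The set of all such $\Delta$ is a $k$-vector space; its dimension is denoted $\operatorname{Frobdim}(A)$. *)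

theory Defs
  imports
    "HOL-Library.Poly_Mapping"
    "HOL-Library.Function_Algebras"
    "Graph_Theory.Arc_Walk"
begin

section \<open>Free vector spaces and their tensor products\<close>

text \<open>
  The \<open>k\<close>-vector space with basis \<open>B\<close> is the set \<open>free_space B\<close> of finitely supported
  functions into \<open>k\<close> that vanish outside \<open>B\<close>.
\<close>

definition free_space :: "'b set \<Rightarrow> ('b \<Rightarrow>\<^sub>0 'k::field) set"
  where "free_space B = {x. Poly_Mapping.keys x \<subseteq> B}"

definition bvec :: "'b \<Rightarrow> 'b \<Rightarrow>\<^sub>0 'k::field"
  where "bvec b = Poly_Mapping.single b 1"

definition fscale :: "'k::field \<Rightarrow> ('b \<Rightarrow>\<^sub>0 'k) \<Rightarrow> ('b \<Rightarrow>\<^sub>0 'k)"  (infixr "*\<^sub>k" 75)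
  where "c *\<^sub>k x = Poly_Mapping.map ((*) c) x"

lemma lookup_fscale [simp]: "Poly_Mapping.lookup (c *\<^sub>k x) b = c * Poly_Mapping.lookup x b"
  by (simp add: fscale_def Poly_Mapping.map.rep_eq when_def)

interpretation free: vector_space fscale
  by unfold_locales (rule poly_mapping_eqI, simp add: lookup_add algebra_simps)+

definition lin_ext :: "('a \<Rightarrow> ('c \<Rightarrow>\<^sub>0 'k::field)) \<Rightarrow> ('a \<Rightarrow>\<^sub>0 'k) \<Rightarrow> ('c \<Rightarrow>\<^sub>0 'k)"
  where "lin_ext f x = (\<Sum>a\<in>Poly_Mapping.keys x. Poly_Mapping.lookup x a *\<^sub>k f a)"

text \<open>
  The tensor product of the spaces with bases \<open>A\<close> and \<open>B\<close> is realised as the space with basis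
  \<open>A \<times> B\<close>; its universal property is proved below.
\<close>

definition tensor :: "('a \<Rightarrow>\<^sub>0 'k::field) \<Rightarrow> ('b \<Rightarrow>\<^sub>0 'k) \<Rightarrow> ('a \<times> 'b \<Rightarrow>\<^sub>0 'k)"  (infixr "\<otimes>\<^sub>k" 73)
  where "x \<otimes>\<^sub>k y = lin_ext (\<lambda>a. lin_ext (\<lambda>b. bvec (a, b)) y) x"

definition tensor_map ::
    "(('a \<Rightarrow>\<^sub>0 'k::field) \<Rightarrow> ('c \<Rightarrow>\<^sub>0 'k)) \<Rightarrow> (('b \<Rightarrow>\<^sub>0 'k) \<Rightarrow> ('d \<Rightarrow>\<^sub>0 'k))
     \<Rightarrow> ('a \<times> 'b \<Rightarrow>\<^sub>0 'k) \<Rightarrow> ('c \<times> 'd \<Rightarrow>\<^sub>0 'k)"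
  where "tensor_map f g = lin_ext (\<lambda>(a, b). f (bvec a) \<otimes>\<^sub>k g (bvec b))"

text \<open>The canonical identifications of the two bracketings of a triple tensor product.\<close>

definition assoc_r :: "(('a \<times> 'b) \<times> 'c \<Rightarrow>\<^sub>0 'k::field) \<Rightarrow> ('a \<times> ('b \<times> 'c) \<Rightarrow>\<^sub>0 'k)"
  where "assoc_r = lin_ext (\<lambda>((a, b), c). bvec (a, (b, c)))"

definition assoc_l :: "('a \<times> ('b \<times> 'c) \<Rightarrow>\<^sub>0 'k::field) \<Rightarrow> (('a \<times> 'b) \<times> 'c \<Rightarrow>\<^sub>0 'k)"
  where "assoc_l = lin_ext (\<lambda>(a, (b, c)). bvec ((a, b), c))"

lemma lin_ext_superset:
  assumes "finite S" "Poly_Mapping.keys x \<subseteq> S"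
  shows "lin_ext f x = (\<Sum>a\<in>S. Poly_Mapping.lookup x a *\<^sub>k f a)"
  unfolding lin_ext_def using assms
  by (intro sum.mono_neutral_left) (auto simp: in_keys_iff)

lemma lin_ext_bvec [simp]: "lin_ext f (bvec a) = f a"
  by (simp add: lin_ext_def bvec_def free.vector_space_assms)

lemma lin_ext_add: "lin_ext f (x + y) = lin_ext f x + lin_ext f y"
proof -
  let ?S = "Poly_Mapping.keys x \<union> Poly_Mapping.keys y"
  have "Poly_Mapping.keys (x + y) \<subseteq> ?S" by (rule Poly_Mapping.keys_add)
  then show ?thesis
    by (subst (1 2 3) lin_ext_superset[where S = ?S])
      (auto simp: lookup_add free.scale_left_distrib sum.distrib)
qed

lemma lin_ext_scale: "lin_ext f (c *\<^sub>k x) = c *\<^sub>k lin_ext f x"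
proof -
  have "Poly_Mapping.keys (c *\<^sub>k x) \<subseteq> Poly_Mapping.keys x" by (auto simp: in_keys_iff)
  then show ?thesis
    by (subst (1 2) lin_ext_superset[where S = "Poly_Mapping.keys x"])
      (auto simp: free.scale_sum_right)
qed

lemma linear_lin_ext: "Vector_Spaces.linear fscale fscale (lin_ext f)"
  by unfold_locales (simp_all add: lin_ext_add lin_ext_scale)

lemma lin_ext_bvec_id: "lin_ext bvec x = x"
  by (rule poly_mapping_eqI)
    (auto simp: lin_ext_def lookup_sum bvec_def lookup_single when_def in_keys_iff if_distrib
      sum.delta' cong: if_cong)

lemma linear_eq_lin_ext:
  assumes "Vector_Spaces.linear fscale fscale L"
  shows "L x = lin_ext (\<lambda>a. L (bvec a)) x"
proof -
  interpret L: Vector_Spaces.linear fscale fscale L by fact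
  have "L x = L (lin_ext bvec x)" by (simp add: lin_ext_bvec_id)
  also have "\<dots> = lin_ext (\<lambda>a. L (bvec a)) x"
    by (simp add: lin_ext_def L.sum L.scale)
  finally show ?thesis .
qed

lemma linear_eq_on_bvec:
  assumes "Vector_Spaces.linear fscale fscale L" "Vector_Spaces.linear fscale fscale M"
    and "\<And>a. a \<in> Poly_Mapping.keys x \<Longrightarrow> L (bvec a) = M (bvec a)"
  shows "L x = M x"
  using assms(3) by (subst (1 2) linear_eq_lin_ext) (auto simp: assms(1,2) lin_ext_def)

lemma lin_ext_add_fun: "lin_ext (\<lambda>a. f a + g a) x = lin_ext f x + lin_ext g x"
  by (simp add: lin_ext_def free.scale_right_distrib sum.distrib)

lemma lin_ext_scale_fun: "lin_ext (\<lambda>a. c *\<^sub>k f a) x = c *\<^sub>k lin_ext f x"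
  by (simp add: lin_ext_def free.scale_sum_right mult.commute)

lemma tensor_bvec [simp]: "bvec a \<otimes>\<^sub>k bvec b = bvec (a, b)"
  by (simp add: tensor_def)

lemma tensor_bilinear:
  "Vector_Spaces.linear fscale fscale (\<lambda>x. x \<otimes>\<^sub>k y)"
  "Vector_Spaces.linear fscale fscale (\<lambda>y. x \<otimes>\<^sub>k y)"
  by (unfold_locales; simp add: tensor_def lin_ext_add lin_ext_scale lin_ext_add_fun
      lin_ext_scale_fun)+

lemma tensor_zero [simp]: "0 \<otimes>\<^sub>k y = 0" "x \<otimes>\<^sub>k 0 = 0"
  by (rule tensor_bilinear[THEN Vector_Spaces.linear.axioms(3), THEN module_hom.zero])+

theorem tensor_universal:
  fixes \<beta> :: "('a \<Rightarrow>\<^sub>0 'k::field) \<Rightarrow> ('b \<Rightarrow>\<^sub>0 'k) \<Rightarrow> ('c \<Rightarrow>\<^sub>0 'k)"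
  assumes "\<And>y. Vector_Spaces.linear fscale fscale (\<lambda>x. \<beta> x y)"
    and "\<And>x. Vector_Spaces.linear fscale fscale (\<beta> x)"
  shows "\<exists>!L. Vector_Spaces.linear fscale fscale L \<and> (\<forall>x y. L (x \<otimes>\<^sub>k y) = \<beta> x y)"
proof
  let ?L = "lin_ext (\<lambda>(a, b). \<beta> (bvec a) (bvec b))"
  have "?L (x \<otimes>\<^sub>k y) = \<beta> x y" for x y
  proof -
    interpret L: Vector_Spaces.linear fscale fscale ?L by (rule linear_lin_ext)
    have "?L (x \<otimes>\<^sub>k y) = lin_ext (\<lambda>a. lin_ext (\<lambda>b. \<beta> (bvec a) (bvec b)) y) x"
      unfolding tensor_def
      by (simp only: lin_ext_def[of _ x] lin_ext_def[of _ y] L.sum L.scale lin_ext_bvec prod.case)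
    also have "\<dots> = \<beta> x y"
      unfolding linear_eq_lin_ext[OF assms(2), symmetric] linear_eq_lin_ext[OF assms(1), symmetric] ..
    finally show ?thesis .
  qed
  then show "Vector_Spaces.linear fscale fscale ?L \<and> (\<forall>x y. ?L (x \<otimes>\<^sub>k y) = \<beta> x y)"
    by (simp add: linear_lin_ext)
  fix L assume L: "Vector_Spaces.linear fscale fscale L \<and> (\<forall>x y. L (x \<otimes>\<^sub>k y) = \<beta> x y)"
  have eq: "L (bvec (a, b)) = \<beta> (bvec a) (bvec b)" for a b
    using L[THEN conjunct2, rule_format, of "bvec a" "bvec b"] by simp
  have "L z = ?L z" for z
    by (rule linear_eq_on_bvec[OF conjunct1[OF L] linear_lin_ext]) (auto simp: eq)
  then show "L = ?L" by (rule ext)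
qed

definition linear_on ::
    "'b set \<Rightarrow> 'c set \<Rightarrow> (('b \<Rightarrow>\<^sub>0 'k::field) \<Rightarrow> ('c \<Rightarrow>\<^sub>0 'k)) \<Rightarrow> bool"
  where "linear_on B C f \<longleftrightarrow>
    (\<forall>x\<in>free_space B. f x \<in> free_space C) \<and>
    (\<forall>x\<in>free_space B. \<forall>y\<in>free_space B. f (x + y) = f x + f y) \<and>
    (\<forall>c. \<forall>x\<in>free_space B. f (c *\<^sub>k x) = c *\<^sub>k f x)"

text \<open>
  Linear maps between subspaces, normalised to be \<open>0\<close> (rather than \<open>undefined\<close>) outside their
  domain, so that they form a subspace of the space of all functions.
\<close>

definition lin_maps :: "'b set \<Rightarrow> 'c set \<Rightarrow> (('b \<Rightarrow>\<^sub>0 'k::field) \<Rightarrow> ('c \<Rightarrow>\<^sub>0 'k)) set"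
  where "lin_maps B C = {f. linear_on B C f \<and> (\<forall>x. x \<notin> free_space B \<longrightarrow> f x = 0)}"

definition map_scale ::
    "'k::field \<Rightarrow> (('b \<Rightarrow>\<^sub>0 'k) \<Rightarrow> ('c \<Rightarrow>\<^sub>0 'k)) \<Rightarrow> (('b \<Rightarrow>\<^sub>0 'k) \<Rightarrow> ('c \<Rightarrow>\<^sub>0 'k))"
  where "map_scale c f = (\<lambda>x. c *\<^sub>k f x)"

interpretation maps: vector_space map_scale
  by unfold_locales
    (simp_all add: map_scale_def fun_eq_iff free.scale_right_distrib free.scale_left_distrib)


section \<open>Nearly Frobenius coproducts\<close>

text \<open>
  An associative unital \<open>k\<close>-algebra, presented on a space with a chosen basis, with its
  multiplication as a linear map on the tensor square.
\<close>

record (overloaded) ('b, 'k) balg =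
  basis :: "'b set"
  mult :: "('b \<times> 'b \<Rightarrow>\<^sub>0 'k) \<Rightarrow> ('b \<Rightarrow>\<^sub>0 'k)"

locale based_algebra =
  fixes A :: "('b, 'k::field) balg" (structure)
  assumes mult_linear: "linear_on (basis A \<times> basis A) (basis A) (mult A)"
    and mult_assoc: "\<lbrakk>x \<in> free_space (basis A); y \<in> free_space (basis A); z \<in> free_space (basis A)\<rbrakk>
      \<Longrightarrow> mult A (mult A (x \<otimes>\<^sub>k y) \<otimes>\<^sub>k z) = mult A (x \<otimes>\<^sub>k mult A (y \<otimes>\<^sub>k z))"
    and ex_unit: "\<exists>u\<in>free_space (basis A). \<forall>x\<in>free_space (basis A).
      mult A (u \<otimes>\<^sub>k x) = x \<and> mult A (x \<otimes>\<^sub>k u) = x"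

definition nearly_frobenius ::
    "('b, 'k::field) balg \<Rightarrow> (('b \<Rightarrow>\<^sub>0 'k) \<Rightarrow> ('b \<times> 'b \<Rightarrow>\<^sub>0 'k)) \<Rightarrow> bool"
  where "nearly_frobenius A \<Delta> \<longleftrightarrow>
    \<Delta> \<in> lin_maps (basis A) (basis A \<times> basis A) \<and>
    (\<forall>x\<in>free_space (basis A). assoc_r (tensor_map \<Delta> id (\<Delta> x)) = tensor_map id \<Delta> (\<Delta> x)) \<and>
    (\<forall>z\<in>free_space (basis A \<times> basis A).
      \<Delta> (mult A z) = tensor_map id (mult A) (assoc_r (tensor_map \<Delta> id z)) \<and>
      \<Delta> (mult A z) = tensor_map (mult A) id (assoc_l (tensor_map id \<Delta> z)))"

definition nearly_frobenius_space ::
    "('b, 'k::field) balg \<Rightarrow> (('b \<Rightarrow>\<^sub>0 'k) \<Rightarrow> ('b \<times> 'b \<Rightarrow>\<^sub>0 'k)) set"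
  where "nearly_frobenius_space A = {\<Delta>. nearly_frobenius A \<Delta>}"

definition Frobdim :: "('b, 'k::field) balg \<Rightarrow> nat"
  where "Frobdim A = maps.dim (nearly_frobenius_space A)"


section \<open>Path algebras of quivers\<close>

text \<open>
  A quiver is a \<^locale>\<open>wf_digraph\<close>, an arrow \<open>a\<close> going from \<open>tail Q a\<close> to \<open>head Q a\<close>.
  A path is stored as its source, its list of arrows, and its target.
\<close>

type_synonym ('v, 'a) qpath = "'v \<times> 'a list \<times> 'v"

definition paths :: "('v, 'a) pre_digraph \<Rightarrow> ('v, 'a) qpath set"
  where "paths Q = {(u, p, v). pre_digraph.awalk Q u p v}"

definition path_prod ::
    "('v, 'a) qpath \<Rightarrow> ('v, 'a) qpath \<Rightarrow> (('v, 'a) qpath \<Rightarrow>\<^sub>0 'k::field)"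
  where "path_prod = (\<lambda>(u, p, v) (u', p', v'). if v = u' then bvec (u, p @ p', v') else 0)"

definition path_algebra :: "('v, 'a) pre_digraph \<Rightarrow> (('v, 'a) qpath, 'k::field) balg"
  where "path_algebra Q = \<lparr>basis = paths Q, mult = lin_ext (\<lambda>(p, q). path_prod p q)\<rparr>"

definition triv :: "'v \<Rightarrow> (('v, 'a) qpath \<Rightarrow>\<^sub>0 'k::field)"
  where "triv v = bvec (v, [], v)"

lemma free_space_sum_scale:
  assumes "\<And>a. a \<in> S \<Longrightarrow> f a \<in> free_space C"
  shows "(\<Sum>a\<in>S. c a *\<^sub>k f a) \<in> free_space C"
proof -
  have "Poly_Mapping.lookup (\<Sum>a\<in>S. c a *\<^sub>k f a) b = 0" if "b \<notin> C" for b
    using assms that by (force simp: lookup_sum free_space_def in_keys_iff intro!: sum.neutral)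
  then show ?thesis by (auto simp: free_space_def in_keys_iff)
qed

lemma path_algebra_based_algebra:
  assumes "wf_digraph Q" "finite (verts Q)"
  shows "based_algebra (path_algebra Q :: (('v, 'a) qpath, 'k::field) balg)"
proof
  interpret Q: wf_digraph Q by fact
  let ?A = "path_algebra Q :: (('v, 'a) qpath, 'k) balg"
  let ?m = "mult ?A"
  have basis: "basis ?A = paths Q" by (simp add: path_algebra_def)
  have m_bvec: "?m (bvec (p, q)) = path_prod p q" for p q by (simp add: path_algebra_def)
  have lin_m: "Vector_Spaces.linear fscale fscale ?m"
    by (simp add: path_algebra_def linear_lin_ext)
  interpret m: Vector_Spaces.linear fscale fscale ?m by (rule lin_m)
  have pp: "path_prod p q \<in> free_space (paths Q)" if "p \<in> paths Q" "q \<in> paths Q" for p q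
    using that by (auto simp: path_prod_def free_space_def bvec_def paths_def split: prod.splits)
  show "linear_on (basis ?A \<times> basis ?A) (basis ?A) ?m"
    unfolding linear_on_def basis
  proof (intro conjI ballI allI)
    fix x :: "('v, 'a) qpath \<times> ('v, 'a) qpath \<Rightarrow>\<^sub>0 'k" assume "x \<in> free_space (paths Q \<times> paths Q)"
    then show "?m x \<in> free_space (paths Q)"
      unfolding path_algebra_def lin_ext_def balg.simps
      by (intro free_space_sum_scale) (auto simp: free_space_def[of "paths Q \<times> paths Q"] pp)
  qed (simp_all add: m.add m.scale)
  show "?m (?m (x \<otimes>\<^sub>k y) \<otimes>\<^sub>k z) = ?m (x \<otimes>\<^sub>k ?m (y \<otimes>\<^sub>k z))" for x y z
  proof -
    note lin = Vector_Spaces.linear_compose[OF tensor_bilinear(1) lin_m, unfolded comp_def]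
      Vector_Spaces.linear_compose[OF tensor_bilinear(2) lin_m, unfolded comp_def]
    note lin' = Vector_Spaces.linear_compose[OF _ lin(1), unfolded comp_def]
      Vector_Spaces.linear_compose[OF _ lin(2), unfolded comp_def]
    have b: "?m (?m (bvec p \<otimes>\<^sub>k bvec q) \<otimes>\<^sub>k bvec r) = ?m (bvec p \<otimes>\<^sub>k ?m (bvec q \<otimes>\<^sub>k bvec r))" for p q r
      by (auto simp: m.zero m_bvec path_prod_def split: prod.splits)
    have "?m (?m (bvec p \<otimes>\<^sub>k bvec q) \<otimes>\<^sub>k z) = ?m (bvec p \<otimes>\<^sub>k ?m (bvec q \<otimes>\<^sub>k z))" for p q
      by (rule linear_eq_on_bvec[OF lin(2) lin'(2)[OF lin(2)] b])
    then have "?m (?m (bvec p \<otimes>\<^sub>k y) \<otimes>\<^sub>k z) = ?m (bvec p \<otimes>\<^sub>k ?m (y \<otimes>\<^sub>k z))" for p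
      by (rule linear_eq_on_bvec[OF lin'(1)[OF lin(2)] lin'(2)[OF lin(1)]])
    then show ?thesis
      by (rule linear_eq_on_bvec[OF lin'(1)[OF lin(1)] lin(1)])
  qed
  show "\<exists>u\<in>free_space (basis ?A). \<forall>x\<in>free_space (basis ?A). ?m (u \<otimes>\<^sub>k x) = x \<and> ?m (x \<otimes>\<^sub>k u) = x"
    unfolding basis
  proof (intro bexI ballI)
    let ?u = "\<Sum>v\<in>verts Q. triv v :: ('v, 'a) qpath \<Rightarrow>\<^sub>0 'k"
    show "?u \<in> free_space (paths Q)"
      using free_space_sum_scale[of "verts Q" triv "paths Q" "\<lambda>_. 1"]
      by (auto simp: free_space_def triv_def bvec_def paths_def Q.awalk_Nil_iff)
    fix x :: "('v, 'a) qpath \<Rightarrow>\<^sub>0 'k" assume x: "x \<in> free_space (paths Q)"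
    note lin = Vector_Spaces.linear_compose[OF tensor_bilinear(1) lin_m, unfolded comp_def]
      Vector_Spaces.linear_compose[OF tensor_bilinear(2) lin_m, unfolded comp_def]
    note sm = lin[THEN Vector_Spaces.linear.axioms(3), THEN module_hom.sum]
    have L: "?m (?u \<otimes>\<^sub>k bvec p) = bvec p" and R: "?m (bvec p \<otimes>\<^sub>k ?u) = bvec p" if "p \<in> paths Q" for p
      using that assms(2)
      by (auto simp: sm triv_def m_bvec path_prod_def paths_def sum.delta sum.delta'
          dest: Q.awalk_hd_in_verts Q.awalk_last_in_verts split: prod.splits)
    have id: "Vector_Spaces.linear fscale fscale (\<lambda>x :: ('v, 'a) qpath \<Rightarrow>\<^sub>0 'k. x)"
      by unfold_locales simp_all
    show "?m (?u \<otimes>\<^sub>k x) = x \<and> ?m (x \<otimes>\<^sub>k ?u) = x"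
    proof
      show "?m (?u \<otimes>\<^sub>k x) = x"
        by (rule linear_eq_on_bvec[OF lin(2) id L]) (use x in \<open>auto simp: free_space_def\<close>)
      show "?m (x \<otimes>\<^sub>k ?u) = x"
        by (rule linear_eq_on_bvec[OF lin(1) id R]) (use x in \<open>auto simp: free_space_def\<close>)
    qed
  qed
qed

text \<open>The linearly oriented quiver \<open>1 \<rightarrow> 2 \<rightarrow> \<dots> \<rightarrow> n\<close>; the arrow \<open>i \<rightarrow> i + 1\<close> is named \<open>i\<close>.\<close>

definition linear_quiver :: "nat \<Rightarrow> (nat, nat) pre_digraph"
  where "linear_quiver n = \<lparr>verts = {1..n}, arcs = {1..<n}, tail = (\<lambda>i. i), head = Suc\<rparr>"

text \<open>
  The path \<open>\<alpha>\<^sub>i \<alpha>\<^sub>i\<^sub>+\<^sub>1 \<dots> \<alpha>\<^sub>j\<close>; note that \<open>seg i (i - 1)\<close> is the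
  empty product at \<open>i\<close>, that is \<open>triv i\<close>, for \<open>i \<ge> 1\<close>.
\<close>

definition seg :: "nat \<Rightarrow> nat \<Rightarrow> ((nat, nat) qpath \<Rightarrow>\<^sub>0 'k::field)"
  where "seg i j = bvec (i, [i..<Suc j], Suc j)"

lemma paths_linear_quiver:
  "paths (linear_quiver n) = {(i, [], i) | i. 1 \<le> i \<and> i \<le> n}
     \<union> {(i, [i..<Suc j], Suc j) | i j. 1 \<le> i \<and> i \<le> j \<and> j \<le> n - 1}"
proof -
  have cas: "pre_digraph.cas (linear_quiver n) u p v \<longleftrightarrow> u \<le> v \<and> p = [u..<v]" for u p v
  proof (induction p arbitrary: u)
    case Nil
    show ?case
      by (auto simp: pre_digraph.cas.simps eq_commute[of "[]" "[u..<v]" for u v])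
  next
    case (Cons a p)
    have "a # p = [u..<v] \<longleftrightarrow> u < v \<and> a = u \<and> p = [Suc u..<v]"
      by (cases "u < v") (auto simp: upt_conv_Cons)
    moreover have "pre_digraph.cas (linear_quiver n) u (a # p) v \<longleftrightarrow>
        a = u \<and> pre_digraph.cas (linear_quiver n) (Suc a) p v"
      by (simp add: pre_digraph.cas.simps linear_quiver_def)
    ultimately show ?case
      using Cons.IH[of "Suc a"] by (metis Suc_le_eq less_imp_le)
  qed
  show ?thesis (is "?L = ?R")
  proof (intro equalityI subsetI)
    fix x assume "x \<in> ?L"
    then obtain u v where x: "x = (u, [u..<v], v)" "1 \<le> u" "u \<le> n" "u \<le> v" "{u..<v} \<subseteq> {1..<n}"
      by (auto simp: paths_def pre_digraph.awalk_def cas) (auto simp: linear_quiver_def)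
    show "x \<in> ?R"
    proof (cases "u = v")
      case False
      then have "v - 1 \<in> {u..<v}" "v = Suc (v - 1)" using x by auto
      then show ?thesis using x by (intro UnI2 CollectI exI[of _ u] exI[of _ "v - 1"]) auto
    qed (use x in auto)
  next
    fix x assume "x \<in> ?R"
    then show "x \<in> ?L"
      by (auto simp: paths_def pre_digraph.awalk_def cas simp del: upt_Suc)
        (auto simp: linear_quiver_def)
  qed
qed

lemma linear_quiver_based_algebra:
  "based_algebra (path_algebra (linear_quiver n) :: ((nat, nat) qpath, 'k::field) balg)"
  by (rule path_algebra_based_algebra, unfold_locales) (auto simp: linear_quiver_def)

lemma seg_empty: "i \<ge> 1 \<Longrightarrow> seg i (i - 1) = triv i"
  by (simp add: seg_def triv_def)

lemma seg_Suc:
  "i \<le> Suc j \<Longrightarrow> mult (path_algebra Q) (seg i j \<otimes>\<^sub>k seg (Suc j) (Suc j)) = seg i (Suc j)"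
  by (simp add: seg_def path_algebra_def path_prod_def)

end

theory Submission
  imports Defs
begin

text \<open>
  Write \<open>p(u,v)\<close> for the unique path from \<open>u\<close> to \<open>v\<close>, where \<open>1 \<le> u \<le> v \<le> n\<close>. These paths are the
  basis of \<open>A\<close>, and all four formulas for \<open>\<Delta>\<close> are instances of the single rule
  \<open>\<Delta> p(u,v) = p(u,n) \<otimes> p(1,v)\<close>. For this rule the axioms are immediate: both sides of
  coassociativity send \<open>p(u,v)\<close> to \<open>p(u,n) \<otimes> p(1,n) \<otimes> p(1,v)\<close>, and multiplying \<open>\<Delta> p(u,v)\<close> by a
  path on the left changes only the source \<open>u\<close>, on the right only the target \<open>v\<close>.

  Conversely, a bimodule map is controlled by its values on the trivial paths, because
  \<open>\<Delta> p(u,v) = \<Delta>(e\<^sub>u) p(u,v) = p(u,v) \<Delta>(e\<^sub>v)\<close>.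
  As \<open>e\<^sub>1 \<Delta>(e\<^sub>1) = \<Delta>(e\<^sub>1) = \<Delta>(e\<^sub>1) e\<^sub>1\<close> and only \<open>e\<^sub>1\<close> ends at the source vertex \<open>1\<close>, the tensor
  \<open>\<Delta>(e\<^sub>1)\<close> is a combination of the \<open>p(1,j) \<otimes> e\<^sub>1\<close>. Now \<open>\<Delta>(e\<^sub>1) p(1,n) = p(1,n) \<Delta>(e\<^sub>n)\<close>, and every
  first factor on the right begins with the longest path \<open>p(1,n)\<close>; hence
  only \<open>j = n\<close> survives and \<open>\<Delta>(e\<^sub>1) = c p(1,n) \<otimes> e\<^sub>1\<close> for a scalar \<open>c\<close>. This \<open>c\<close> determines the rest:
  \<open>p(1,v) \<Delta>(e\<^sub>v) = \<Delta>(e\<^sub>1) p(1,v) = c p(1,n) \<otimes> p(1,v)\<close>, and prepending \<open>p(1,v)\<close> is injective on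
  paths that start at \<open>v\<close>, so that \<open>\<Delta>(e\<^sub>v) = c p(v,n) \<otimes> p(1,v)\<close>.

  In the formalization, \<open>nearly_frobenius_path_algebra_iff\<close> reduces the axioms to basis elements of a
  path algebra, \<open>lookup_left_act_append\<close> and \<open>lookup_right_act_append\<close> say that prepending or
  appending a path merely relabels coefficients, and \<open>coproduct_bvec\<close> is the computation of the
  preceding paragraph. For \<open>n = 1\<close> it degenerates correctly, since then \<open>p(1,n) = e\<^sub>1\<close>.
\<close>

section \<open>Linear maps given on a basis\<close>

lemma lookup_bvec: "Poly_Mapping.lookup (bvec a) b = (if a = b then 1 else 0)"
  by (simp add: bvec_def lookup_single when_def)

lemma bvec_nonzero [simp]: "bvec a \<noteq> 0"
  by (metis lookup_bvec lookup_zero one_neq_zero)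

lemma lookup_lin_ext:
  "Poly_Mapping.lookup (lin_ext f x) b
    = (\<Sum>a\<in>Poly_Mapping.keys x. Poly_Mapping.lookup x a * Poly_Mapping.lookup (f a) b)"
  by (simp add: lin_ext_def lookup_sum)

lemma lin_ext_zero [simp]: "lin_ext f 0 = 0"
  by (simp add: lin_ext_def)

lemma lin_ext_cong:
  "(\<And>a. a \<in> Poly_Mapping.keys x \<Longrightarrow> f a = g a) \<Longrightarrow> lin_ext f x = lin_ext g x"
  by (simp add: lin_ext_def)

lemma lin_ext_lin_ext: "lin_ext f (lin_ext g x) = lin_ext (\<lambda>a. lin_ext f (g a)) x"
proof -
  interpret f: Vector_Spaces.linear fscale fscale "lin_ext f" by (rule linear_lin_ext)
  show ?thesis by (simp add: lin_ext_def[of g] lin_ext_def[of _ x] f.sum f.scale)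
qed

lemma bvec_tensor: "bvec a \<otimes>\<^sub>k y = lin_ext (\<lambda>b. bvec (a, b)) y"
  by (simp add: tensor_def)

lemma tensor_of_bvec: "x \<otimes>\<^sub>k bvec b = lin_ext (\<lambda>a. bvec (a, b)) x"
  by (simp add: tensor_def)

lemma bvec_in_free_space_iff [simp]: "bvec a \<in> free_space B \<longleftrightarrow> a \<in> B"
  by (simp add: free_space_def bvec_def)

lemma lin_ext_in_free_space:
  assumes "x \<in> free_space B" "\<And>a. a \<in> B \<Longrightarrow> f a \<in> free_space C"
  shows "lin_ext f x \<in> free_space C"
  using assms unfolding lin_ext_def by (intro free_space_sum_scale) (auto simp: free_space_def)

lemma linear_on_eq_lin_ext:
  assumes "linear_on B C f" "x \<in> free_space B"
  shows "f x = lin_ext (\<lambda>a. f (bvec a)) x"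
proof -
  have z: "f 0 = 0"
    using assms unfolding linear_on_def by (metis free.scale_zero_left)
  have *: "f (\<Sum>a\<in>S. c a *\<^sub>k bvec a) = (\<Sum>a\<in>S. c a *\<^sub>k f (bvec a))"
    if "finite S" "S \<subseteq> B" for S c
    using that
  proof (induction S)
    case (insert a S)
    have "(\<Sum>a\<in>S. c a *\<^sub>k bvec a) \<in> free_space B"
      using insert.prems by (intro free_space_sum_scale) auto
    moreover have "c a *\<^sub>k bvec a \<in> free_space B" "bvec a \<in> free_space B"
      using insert.prems free_space_sum_scale[of "{a}" bvec B c] by auto
    ultimately show ?case
      using insert assms(1) by (simp add: linear_on_def)
  qed (simp add: z)
  have "f (lin_ext bvec x) = lin_ext (\<lambda>a. f (bvec a)) x"
    unfolding lin_ext_def using assms(2) by (intro *) (auto simp: free_space_def)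
  then show ?thesis by (simp add: lin_ext_bvec_id)
qed

text \<open>
  The linear extension itself is defined, and in general nonzero, on all finitely supported
  functions; membership in \<open>lin_maps\<close> requires the value \<open>0\<close> off the span of \<open>B\<close>.
\<close>

definition lin_map_on :: "'b set \<Rightarrow> ('b \<Rightarrow> ('c \<Rightarrow>\<^sub>0 'k::field)) \<Rightarrow> ('b \<Rightarrow>\<^sub>0 'k) \<Rightarrow> ('c \<Rightarrow>\<^sub>0 'k)"
  where "lin_map_on B f x = (if x \<in> free_space B then lin_ext f x else 0)"

lemma lin_map_on_bvec: "a \<in> B \<Longrightarrow> lin_map_on B f (bvec a) = f a"
  by (simp add: lin_map_on_def)

lemma lin_map_on_in_lin_maps:
  assumes "\<And>a. a \<in> B \<Longrightarrow> f a \<in> free_space C"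
  shows "lin_map_on B f \<in> lin_maps B C"
proof -
  have "x + y \<in> free_space B" if "x \<in> free_space B" "y \<in> free_space B" for x y
    using that Poly_Mapping.keys_add[of x y] by (auto simp: free_space_def)
  moreover have "c *\<^sub>k x \<in> free_space B" if "x \<in> free_space B" for x c
    using that by (auto simp: free_space_def in_keys_iff)
  ultimately show ?thesis
    using assms
    by (auto simp: lin_maps_def linear_on_def lin_map_on_def lin_ext_add lin_ext_scale
        intro: lin_ext_in_free_space)
qed

lemma lin_maps_eqI:
  assumes "f \<in> lin_maps B C" "g \<in> lin_maps B C" "\<And>a. a \<in> B \<Longrightarrow> f (bvec a) = g (bvec a)"
  shows "f = g"
proof
  fix x show "f x = g x"
  proof (cases "x \<in> free_space B")
    case True
    then have "lin_ext (\<lambda>a. f (bvec a)) x = lin_ext (\<lambda>a. g (bvec a)) x"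
      using assms(3) by (intro lin_ext_cong) (auto simp: free_space_def)
    with True show ?thesis
      using assms(1,2) linear_on_eq_lin_ext unfolding lin_maps_def by (metis (mono_tags) mem_Collect_eq)
  qed (use assms in \<open>simp add: lin_maps_def\<close>)
qed

lemma lin_maps_scale:
  assumes "f \<in> lin_maps B C"
  shows "map_scale c f \<in> lin_maps B C"
proof -
  have "c *\<^sub>k x \<in> free_space C" if "x \<in> free_space C" for x
    using that by (auto simp: free_space_def in_keys_iff)
  then show ?thesis
    using assms
    by (auto simp: lin_maps_def linear_on_def map_scale_def free.scale_right_distrib mult.commute)
qed


section \<open>Coproducts on path algebras\<close>

text \<open>
  The action of a path on \<open>A \<otimes> A\<close> through the outer bimodule structure,
  \<open>p \<cdot> (a \<otimes> b) = p a \<otimes> b\<close> and \<open>(a \<otimes> b) \<cdot> q = a \<otimes> b q\<close>.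
\<close>

definition left_act ::
    "('v, 'a) qpath \<Rightarrow> (('v, 'a) qpath \<times> ('v, 'a) qpath \<Rightarrow>\<^sub>0 'k::field)
     \<Rightarrow> (('v, 'a) qpath \<times> ('v, 'a) qpath \<Rightarrow>\<^sub>0 'k)"
  where "left_act p = lin_ext (\<lambda>(a, b). path_prod p a \<otimes>\<^sub>k bvec b)"

definition right_act ::
    "('v, 'a) qpath \<Rightarrow> (('v, 'a) qpath \<times> ('v, 'a) qpath \<Rightarrow>\<^sub>0 'k::field)
     \<Rightarrow> (('v, 'a) qpath \<times> ('v, 'a) qpath \<Rightarrow>\<^sub>0 'k)"
  where "right_act q = lin_ext (\<lambda>(a, b). bvec a \<otimes>\<^sub>k path_prod b q)"

text \<open>
  Prepending a fixed path is injective on the paths that start at its target, so each coefficient of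
  \<open>p \<cdot> w\<close> comes from at most one coefficient of \<open>w\<close>. The next lemmas say which one, on either side.
\<close>

lemma lookup_left_act_append:
  fixes w :: "_ \<Rightarrow>\<^sub>0 'k::field"
  shows "Poly_Mapping.lookup (left_act (u, p, v) w) ((u, p @ r, z), b)
    = Poly_Mapping.lookup w ((v, r, z), b)"
proof -
  have "Poly_Mapping.lookup (case ab of (a, b) \<Rightarrow> path_prod (u, p, v) a \<otimes>\<^sub>k bvec b) ((u, p @ r, z), b)
      = (if ab = ((v, r, z), b) then 1 else (0::'k))" for ab
    by (auto simp: path_prod_def lookup_bvec split: prod.splits)
  then show ?thesis
    unfolding left_act_def lookup_lin_ext
    by (simp only:) (simp add: if_distrib in_keys_iff sum.delta cong: if_cong)
qed

lemma lookup_left_act_eq_0: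
  assumes "x \<noteq> u \<or> (\<forall>r'. r \<noteq> p @ r')"
  shows "Poly_Mapping.lookup (left_act (u, p, v) w) ((x, r, z), b) = 0"
  using assms unfolding left_act_def lookup_lin_ext
  by (intro sum.neutral) (auto simp: path_prod_def lookup_bvec split: prod.splits)

lemma lookup_right_act_append:
  fixes w :: "_ \<Rightarrow>\<^sub>0 'k::field"
  shows "Poly_Mapping.lookup (right_act (u, p, v) w) (a, (x, r @ p, v))
    = Poly_Mapping.lookup w (a, (x, r, u))"
proof -
  have "Poly_Mapping.lookup (case ab of (a, b) \<Rightarrow> bvec a \<otimes>\<^sub>k path_prod b (u, p, v)) (a, (x, r @ p, v))
      = (if ab = (a, (x, r, u)) then 1 else (0::'k))" for ab
    by (auto simp: path_prod_def lookup_bvec split: prod.splits)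
  then show ?thesis
    unfolding right_act_def lookup_lin_ext
    by (simp only:) (simp add: if_distrib in_keys_iff sum.delta cong: if_cong)
qed

lemma lookup_right_act_eq_0:
  assumes "z \<noteq> v"
  shows "Poly_Mapping.lookup (right_act (u, p, v) w) (a, (x, r, z)) = 0"
  using assms unfolding right_act_def lookup_lin_ext
  by (intro sum.neutral) (auto simp: path_prod_def lookup_bvec split: prod.splits)

lemma mult_path_algebra_bvec: "mult (path_algebra Q) (bvec (p, q)) = path_prod p q"
  by (simp add: path_algebra_def)

text \<open>
  The right-hand sides of the two bimodule axioms are the outer actions, applied to pure tensors of
  paths and extended linearly.
\<close>

lemma tensor_map_mult_right:
  fixes z :: "_ \<Rightarrow>\<^sub>0 'k::field"
  shows "tensor_map id (mult (path_algebra Q)) (assoc_r (tensor_map \<Delta> id z))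
    = lin_ext (\<lambda>(p, q). right_act q (\<Delta> (bvec p))) z"
proof -
  have "tensor_map id (mult (path_algebra Q)) (assoc_r (w \<otimes>\<^sub>k bvec q)) = right_act q w"
    for q and w :: "_ \<Rightarrow>\<^sub>0 'k"
    by (simp add: tensor_of_bvec tensor_map_def assoc_r_def lin_ext_lin_ext right_act_def
        case_prod_unfold mult_path_algebra_bvec)
  then show ?thesis
    by (simp add: tensor_map_def[of \<Delta>] tensor_map_def[of id "mult _"] assoc_r_def lin_ext_lin_ext
        case_prod_unfold)
qed

lemma tensor_map_mult_left:
  fixes z :: "_ \<Rightarrow>\<^sub>0 'k::field"
  shows "tensor_map (mult (path_algebra Q)) id (assoc_l (tensor_map id \<Delta> z))
    = lin_ext (\<lambda>(p, q). left_act p (\<Delta> (bvec q))) z"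
proof -
  have "tensor_map (mult (path_algebra Q)) id (assoc_l (bvec p \<otimes>\<^sub>k w)) = left_act p w"
    for p and w :: "_ \<Rightarrow>\<^sub>0 'k"
    by (simp add: bvec_tensor tensor_map_def assoc_l_def lin_ext_lin_ext left_act_def
        case_prod_unfold mult_path_algebra_bvec)
  then show ?thesis
    by (simp add: tensor_map_def[of id \<Delta>] tensor_map_def[of "mult _" id] assoc_l_def lin_ext_lin_ext
        case_prod_unfold)
qed

text \<open>
  Every map in the axioms is linear, so the axioms need only be tested on paths and pairs of paths.
\<close>

lemma nearly_frobenius_path_algebra_iff:
  fixes \<Delta> :: "(('v, 'a) qpath \<Rightarrow>\<^sub>0 'k::field) \<Rightarrow> _"
  assumes "wf_digraph Q"
  shows "nearly_frobenius (path_algebra Q) \<Delta> \<longleftrightarrow>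
    \<Delta> \<in> lin_maps (paths Q) (paths Q \<times> paths Q) \<and>
    (\<forall>p\<in>paths Q. assoc_r (tensor_map \<Delta> id (\<Delta> (bvec p))) = tensor_map id \<Delta> (\<Delta> (bvec p))) \<and>
    (\<forall>p\<in>paths Q. \<forall>q\<in>paths Q. \<Delta> (path_prod p q) = right_act q (\<Delta> (bvec p)) \<and>
      \<Delta> (path_prod p q) = left_act p (\<Delta> (bvec q)))" (is "?L \<longleftrightarrow> ?lin \<and> ?coassoc \<and> ?bimod")
proof -
  interpret wf_digraph Q by fact
  have basis: "basis (path_algebra Q) = paths Q"
    and mult: "mult (path_algebra Q) = lin_ext (\<lambda>(p, q). path_prod p q)"
    by (simp_all add: path_algebra_def)
  show ?thesis
  proof (intro iffI)
    assume L: ?L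
    have "\<Delta> (path_prod p q) = right_act q (\<Delta> (bvec p)) \<and> \<Delta> (path_prod p q) = left_act p (\<Delta> (bvec q))"
      if "p \<in> paths Q" "q \<in> paths Q" for p q
      using that L unfolding nearly_frobenius_def basis tensor_map_mult_left tensor_map_mult_right
      by (auto dest!: bspec[of _ _ "bvec (p, q)"] simp: mult_path_algebra_bvec)
    then have ?bimod by blast
    moreover have ?lin ?coassoc
      using L by (auto simp: nearly_frobenius_def basis)
    ultimately show "?lin \<and> ?coassoc \<and> ?bimod" by blast
  next
    assume R: "?lin \<and> ?coassoc \<and> ?bimod"
    then have lin: "linear_on (paths Q) (paths Q \<times> paths Q) \<Delta>"
      by (simp add: lin_maps_def)
    note ext = linear_on_eq_lin_ext[OF lin]
    have coassoc: "assoc_r (tensor_map \<Delta> id (\<Delta> x)) = tensor_map id \<Delta> (\<Delta> x)"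
      if x: "x \<in> free_space (paths Q)" for x
    proof -
      have "assoc_r (tensor_map \<Delta> id (lin_ext f x)) = lin_ext (\<lambda>a. assoc_r (tensor_map \<Delta> id (f a))) x"
        "tensor_map id \<Delta> (lin_ext f x) = lin_ext (\<lambda>a. tensor_map id \<Delta> (f a)) x" for f
        by (simp_all add: tensor_map_def assoc_r_def lin_ext_lin_ext)
      then show ?thesis
        unfolding ext[OF x] using R x by (auto simp: free_space_def intro!: lin_ext_cong)
    qed
    have pp: "path_prod p q \<in> free_space (paths Q)" if "p \<in> paths Q" "q \<in> paths Q" for p q
      using that
      by (auto simp: path_prod_def paths_def free_space_def bvec_def split: prod.splits)
    have "\<Delta> (mult (path_algebra Q) z) = lin_ext (\<lambda>(p, q). \<Delta> (path_prod p q)) z"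
      if z: "z \<in> free_space (paths Q \<times> paths Q)" for z
    proof -
      have "mult (path_algebra Q) z \<in> free_space (paths Q)"
        unfolding mult using z by (rule lin_ext_in_free_space) (auto simp: pp)
      then have "\<Delta> (mult (path_algebra Q) z)
          = lin_ext (\<lambda>(p, q). lin_ext (\<lambda>a. \<Delta> (bvec a)) (path_prod p q)) z"
        by (simp add: ext mult lin_ext_lin_ext case_prod_unfold)
      also have "\<dots> = lin_ext (\<lambda>(p, q). \<Delta> (path_prod p q)) z"
        using z by (intro lin_ext_cong) (auto simp: free_space_def[of "_ \<times> _"] ext[OF pp])
      finally show ?thesis .
    qed
    moreover have "lin_ext (\<lambda>(p, q). \<Delta> (path_prod p q)) z = lin_ext (\<lambda>(p, q). right_act q (\<Delta> (bvec p))) z"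
      "lin_ext (\<lambda>(p, q). \<Delta> (path_prod p q)) z = lin_ext (\<lambda>(p, q). left_act p (\<Delta> (bvec q))) z"
      if "z \<in> free_space (paths Q \<times> paths Q)" for z
      using that R by (auto simp: free_space_def intro!: lin_ext_cong)
    ultimately show ?L
      using R coassoc
      unfolding nearly_frobenius_def basis tensor_map_mult_left tensor_map_mult_right by simp
  qed
qed

text \<open>
  Coassociativity is quadratic in \<open>\<Delta>\<close>, but homogeneous: scaling \<open>\<Delta>\<close> by \<open>c\<close> multiplies both sides
  by \<open>c\<^sup>2\<close>.
\<close>

lemma nearly_frobenius_scale:
  assumes "nearly_frobenius A \<Delta>"
  shows "nearly_frobenius A (map_scale c \<Delta>)"
proof -
  have t: "(c *\<^sub>k x) \<otimes>\<^sub>k y = c *\<^sub>k (x \<otimes>\<^sub>k y)" "x \<otimes>\<^sub>k (c *\<^sub>k y) = c *\<^sub>k (x \<otimes>\<^sub>k y)"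
    for x :: "'x \<Rightarrow>\<^sub>0 'b" and y :: "'y \<Rightarrow>\<^sub>0 'b"
    by (simp_all add: tensor_def lin_ext_scale lin_ext_scale_fun)
  have tm: "tensor_map (map_scale c \<Delta>) id x = c *\<^sub>k tensor_map \<Delta> id x"
    "tensor_map id (map_scale c \<Delta>) x = c *\<^sub>k tensor_map id \<Delta> x" for x
    by (simp_all add: tensor_map_def map_scale_def case_prod_unfold t lin_ext_scale_fun)
  have s: "tensor_map f g (c *\<^sub>k x) = c *\<^sub>k tensor_map f g x"
    for f :: "('x \<Rightarrow>\<^sub>0 'b) \<Rightarrow> ('y \<Rightarrow>\<^sub>0 'b)" and g :: "('u \<Rightarrow>\<^sub>0 'b) \<Rightarrow> ('v \<Rightarrow>\<^sub>0 'b)" and x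
    by (simp add: tensor_map_def lin_ext_scale)
  have a: "assoc_r (c *\<^sub>k x) = c *\<^sub>k assoc_r x" "assoc_l (c *\<^sub>k y) = c *\<^sub>k assoc_l y"
    for x :: "('x \<times> 'y) \<times> 'z \<Rightarrow>\<^sub>0 'b" and y :: "'x \<times> 'y \<times> 'z \<Rightarrow>\<^sub>0 'b"
    by (simp_all add: assoc_r_def assoc_l_def lin_ext_scale)
  have m: "map_scale c \<Delta> x = c *\<^sub>k \<Delta> x" for x
    by (simp add: map_scale_def)
  show ?thesis
    using assms lin_maps_scale[of \<Delta> "basis A" "basis A \<times> basis A" c]
    unfolding nearly_frobenius_def by (intro conjI ballI; (simp only: m tm s a)?; metis)
qed


section \<open>The linear quiver\<close>

lemma wf_digraph_linear_quiver: "wf_digraph (linear_quiver n)"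
  by unfold_locales (auto simp: linear_quiver_def)

lemmas nearly_frobenius_linear_quiver_iff =
  nearly_frobenius_path_algebra_iff[OF wf_digraph_linear_quiver]

abbreviation qp :: "nat \<Rightarrow> nat \<Rightarrow> (nat, nat) qpath"
  where "qp u v \<equiv> (u, [u..<v], v)"

lemma paths_linear_quiver_qp:
  "paths (linear_quiver n) = {qp u v | u v. 1 \<le> u \<and> u \<le> v \<and> v \<le> n}"
proof -
  have "(\<exists>i j. x = (i, [i..<Suc j], Suc j) \<and> 1 \<le> i \<and> i \<le> j \<and> j \<le> n - 1)
      \<longleftrightarrow> (\<exists>u v. x = qp u v \<and> 1 \<le> u \<and> u < v \<and> v \<le> n)" for x
  proof safe
    fix u v assume "1 \<le> u" "u < v" "v \<le> n"
    then show "\<exists>i j. qp u v = (i, [i..<Suc j], Suc j) \<and> 1 \<le> i \<and> i \<le> j \<and> j \<le> n - 1"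
      by (intro exI[of _ u] exI[of _ "v - 1"]) auto
  qed (auto simp del: upt_Suc)
  then show ?thesis
    unfolding paths_linear_quiver by (auto simp: le_less)
qed

lemma path_prod_qp:
  "u \<le> v \<Longrightarrow> v \<le> w \<Longrightarrow> path_prod (qp u v) (qp v w) = bvec (qp u w)"
  using upt_add_eq_append[of u v "w - v"] by (simp add: path_prod_def)

definition linear_coproduct ::
    "nat \<Rightarrow> ((nat, nat) qpath \<Rightarrow>\<^sub>0 'k::field) \<Rightarrow> ((nat, nat) qpath \<times> (nat, nat) qpath \<Rightarrow>\<^sub>0 'k)"
  where "linear_coproduct n =
    lin_map_on (paths (linear_quiver n)) (\<lambda>(u, _, v). bvec (qp u n, qp 1 v))"

lemma linear_coproduct_bvec:
  assumes "1 \<le> u" "u \<le> v" "v \<le> n"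
  shows "linear_coproduct n (bvec (qp u v)) = bvec (qp u n) \<otimes>\<^sub>k bvec (qp 1 v)"
  using assms unfolding linear_coproduct_def
  by (subst lin_map_on_bvec) (auto simp: paths_linear_quiver_qp)

lemma nearly_frobenius_linear_coproduct:
  "nearly_frobenius (path_algebra (linear_quiver n)) (linear_coproduct n)"
  unfolding nearly_frobenius_linear_quiver_iff
proof (intro conjI ballI)
  let ?P = "paths (linear_quiver n)"
  show "linear_coproduct n \<in> lin_maps ?P (?P \<times> ?P)"
    unfolding linear_coproduct_def
    by (rule lin_map_on_in_lin_maps) (auto simp: paths_linear_quiver_qp)
  fix p assume "p \<in> ?P"
  then obtain u v where p: "p = qp u v" "1 \<le> u" "u \<le> v" "v \<le> n"
    by (auto simp: paths_linear_quiver_qp)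
  show "assoc_r (tensor_map (linear_coproduct n) id (linear_coproduct n (bvec p)))
      = tensor_map id (linear_coproduct n) (linear_coproduct n (bvec p))"
    using p by (simp add: linear_coproduct_bvec tensor_map_def assoc_r_def)
  fix q assume "q \<in> ?P"
  then obtain u' v' where q: "q = qp u' v'" "1 \<le> u'" "u' \<le> v'" "v' \<le> n"
    by (auto simp: paths_linear_quiver_qp)
  have z: "linear_coproduct n 0 = 0"
    by (simp add: linear_coproduct_def lin_map_on_def)
  show "linear_coproduct n (path_prod p q) = right_act q (linear_coproduct n (bvec p))"
  proof (cases "v = u'")
    case True
    then show ?thesis
      using p q by (simp add: path_prod_qp linear_coproduct_bvec right_act_def del: One_nat_def)
  qed (use p q z in \<open>simp add: linear_coproduct_bvec right_act_def path_prod_def\<close>)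
  show "linear_coproduct n (path_prod p q) = left_act p (linear_coproduct n (bvec q))"
  proof (cases "v = u'")
    case True
    then show ?thesis
      using p q by (simp add: path_prod_qp linear_coproduct_bvec left_act_def)
  qed (use p q z in \<open>simp add: linear_coproduct_bvec left_act_def path_prod_def\<close>)
qed

text \<open>
  The bimodule axioms propagate one scalar, the coefficient \<open>c\<close> of \<open>p(1,n) \<otimes> e\<^sub>1\<close> in \<open>\<Delta>(e\<^sub>1)\<close>, to the
  whole algebra: comparing the two expressions for \<open>\<Delta> p(1,n)\<close> isolates it, comparing those for
  \<open>\<Delta> p(1,v)\<close> transports it to \<open>\<Delta>(e\<^sub>v)\<close>.
\<close>

lemma coproduct_bvec:
  fixes \<Delta> :: "((nat, nat) qpath \<Rightarrow>\<^sub>0 'k::field) \<Rightarrow> _"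
  assumes "n \<ge> 1" and nf: "nearly_frobenius (path_algebra (linear_quiver n)) \<Delta>"
  obtains c where "\<And>u v. 1 \<le> u \<Longrightarrow> u \<le> v \<Longrightarrow> v \<le> n \<Longrightarrow>
    \<Delta> (bvec (qp u v)) = c *\<^sub>k bvec (qp u n, qp 1 v)"
proof -
  let ?P = "paths (linear_quiver n)"
  let ?lk = Poly_Mapping.lookup
  define w where "w v = \<Delta> (bvec (qp v v))" for v
  define c where "c = ?lk (w 1) (qp 1 n, qp 1 1)"
  have R: "\<Delta> (bvec (qp u v)) = right_act (qp u v) (w u)"
    and L: "\<Delta> (bvec (qp u v)) = left_act (qp u v) (w v)" if "1 \<le> u" "u \<le> v" "v \<le> n" for u v
  proof -
    have "qp u u \<in> ?P" "qp u v \<in> ?P" "qp v v \<in> ?P"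
      using that by (auto simp: paths_linear_quiver_qp)
    then have "\<Delta> (path_prod (qp u u) (qp u v)) = right_act (qp u v) (\<Delta> (bvec (qp u u)))"
      "\<Delta> (path_prod (qp u v) (qp v v)) = left_act (qp u v) (\<Delta> (bvec (qp v v)))"
      using nf unfolding nearly_frobenius_linear_quiver_iff by blast+
    then show "\<Delta> (bvec (qp u v)) = right_act (qp u v) (w u)"
      "\<Delta> (bvec (qp u v)) = left_act (qp u v) (w v)"
      using that by (simp_all only: path_prod_qp order_refl w_def)
  qed
  have source: "?lk (w v) ((x, r, z), b) = 0" if "1 \<le> v" "v \<le> n" "x \<noteq> v" for v x r z b
    using L[of v v] that lookup_left_act_eq_0[of x v r "[v..<v]" v "w v" z b]
    by (metis order_refl w_def)
  have target: "?lk (w v) (a, (x, r, z)) = 0" if "1 \<le> v" "v \<le> n" "z \<noteq> v" for v x r z a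
    using R[of v v] that lookup_right_act_eq_0[of z v v "[v..<v]" "w v" a x r]
    by (metis order_refl w_def)
  have w1: "w 1 = c *\<^sub>k bvec (qp 1 n, qp 1 1)"
  proof (rule poly_mapping_eqI)
    fix ab :: "(nat, nat) qpath \<times> (nat, nat) qpath"
    obtain x r z b where ab: "ab = ((x, r, z), b)" by (metis prod.exhaust)
    show "?lk (w 1) ab = ?lk (c *\<^sub>k bvec (qp 1 n, qp 1 1)) ab"
    proof (cases "ab = (qp 1 n, qp 1 1) \<or> ?lk (w 1) ab = 0")
      case False
      then have nz: "?lk (w 1) ab \<noteq> 0" and ne: "ab \<noteq> (qp 1 n, qp 1 1)" by auto
      have "bvec (qp 1 1) \<in> free_space ?P"
        using \<open>n \<ge> 1\<close> by (auto simp: paths_linear_quiver_qp)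
      then have "w 1 \<in> free_space (?P \<times> ?P)"
        using nf unfolding w_def nearly_frobenius_linear_quiver_iff lin_maps_def linear_on_def by blast
      then have "ab \<in> ?P \<times> ?P"
        using nz by (auto simp: free_space_def in_keys_iff)
      then obtain i j i' j' where "ab = (qp i j, qp i' j')"
        "1 \<le> i" "i \<le> j" "j \<le> n" "1 \<le> i'" "i' \<le> j'"
        by (auto simp: paths_linear_quiver_qp)
      moreover from this have "i = 1" "j' = 1"
        using nz source[of 1 i] target[of 1 j'] \<open>n \<ge> 1\<close> by (metis order_refl)+
      ultimately have ab: "ab = (qp 1 j, qp 1 1)" and j: "1 \<le> j" "j \<le> n" by auto
      with ne have "j < n" by (cases "j = n") auto
      \<comment> \<open>A first factor of \<open>p(1,n) \<Delta>(e\<^sub>n)\<close> has at least \<open>n - 1\<close> arrows, \<open>p(1,j)\<close> has \<open>j - 1\<close>.\<close>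
      then have "length [1..<j] < length [1..<n]" using j by simp
      then have no: "[1..<j] \<noteq> [1..<n] @ r'" for r' by (metis length_append not_add_less1)
      have "?lk (w 1) ab = ?lk (right_act (qp 1 n) (w 1)) (qp 1 j, qp 1 n)"
        using lookup_right_act_append[of 1 "[1..<n]" n "w 1" "qp 1 j" 1 "[]"] ab by simp
      also have "\<dots> = ?lk (left_act (qp 1 n) (w n)) (qp 1 j, qp 1 n)"
        using R[of 1 n] L[of 1 n] \<open>n \<ge> 1\<close> by simp
      also have "\<dots> = 0"
        using no by (intro lookup_left_act_eq_0) blast
      finally show ?thesis using nz by simp
    qed (auto simp: c_def lookup_bvec)
  qed
  have wv: "w v = c *\<^sub>k bvec (qp v n, qp 1 v)" if v: "1 \<le> v" "v \<le> n" for v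
  proof (rule poly_mapping_eqI)
    fix ab :: "(nat, nat) qpath \<times> (nat, nat) qpath"
    obtain x r z b where ab: "ab = ((x, r, z), b)" by (metis prod.exhaust)
    have app: "[1..<n] = [1..<v] @ [v..<n]" using upt_add_eq_append[of 1 v "n - v"] v by simp
    show "?lk (w v) ab = ?lk (c *\<^sub>k bvec (qp v n, qp 1 v)) ab"
    proof (cases "x = v")
      case True
      \<comment> \<open>Cancel \<open>p(1,v)\<close>: the coefficient is visible in \<open>p(1,v) \<Delta>(e\<^sub>v) = \<Delta>(e\<^sub>1) p(1,v)\<close>.\<close>
      have "?lk (w v) ab = ?lk (left_act (qp 1 v) (w v)) ((1, [1..<v] @ r, z), b)"
        by (simp only: ab True lookup_left_act_append)
      also have "left_act (qp 1 v) (w v) = right_act (qp 1 v) (w 1)"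
        using L[of 1 v] R[of 1 v] v by simp
      also have "\<dots> = c *\<^sub>k bvec (qp 1 n, qp 1 v)"
        unfolding w1 by (simp add: right_act_def lin_ext_scale path_prod_def)
      also have "?lk \<dots> ((1, [1..<v] @ r, z), b) = ?lk (c *\<^sub>k bvec (qp v n, qp 1 v)) ab"
        unfolding lookup_fscale lookup_bvec ab True app by auto
      finally show ?thesis .
    qed (use source v ab in \<open>auto simp: lookup_bvec\<close>)
  qed
  show thesis
  proof (rule that)
    fix u v assume uv: "1 \<le> u" "u \<le> v" "v \<le> n"
    have "\<Delta> (bvec (qp u v)) = c *\<^sub>k (bvec (qp u n) \<otimes>\<^sub>k path_prod (qp 1 u) (qp u v))"
      using R[OF uv] wv[of u] uv by (simp add: right_act_def lin_ext_scale)
    also have "\<dots> = c *\<^sub>k bvec (qp u n, qp 1 v)"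
      using uv by (simp only: path_prod_qp tensor_bvec)
    finally show "\<Delta> (bvec (qp u v)) = c *\<^sub>k bvec (qp u n, qp 1 v)" .
  qed
qed

lemma nearly_frobenius_space_linear_quiver:
  assumes "n \<ge> 1"
  shows "nearly_frobenius_space (path_algebra (linear_quiver n)) = maps.span {linear_coproduct n}"
proof -
  let ?A = "path_algebra (linear_quiver n)"
  let ?P = "paths (linear_quiver n)"
  have "\<Delta> \<in> range (\<lambda>c. map_scale c (linear_coproduct n))" if nf: "nearly_frobenius ?A \<Delta>" for \<Delta>
  proof -
    obtain c where c: "\<And>u v. 1 \<le> u \<Longrightarrow> u \<le> v \<Longrightarrow> v \<le> n \<Longrightarrow>
        \<Delta> (bvec (qp u v)) = c *\<^sub>k bvec (qp u n, qp 1 v)"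
      using coproduct_bvec[OF assms nf] by blast
    have "\<Delta> = map_scale c (linear_coproduct n)"
    proof (rule lin_maps_eqI)
      show "\<Delta> \<in> lin_maps ?P (?P \<times> ?P)" "map_scale c (linear_coproduct n) \<in> lin_maps ?P (?P \<times> ?P)"
        using nf nearly_frobenius_scale[OF nearly_frobenius_linear_coproduct]
        unfolding nearly_frobenius_linear_quiver_iff by blast+
    qed (auto simp: paths_linear_quiver_qp map_scale_def c linear_coproduct_bvec)
    then show ?thesis by blast
  qed
  then show ?thesis
    using nearly_frobenius_scale[OF nearly_frobenius_linear_coproduct]
    by (auto simp: nearly_frobenius_space_def maps.span_singleton)
qed

theorem lemma4p1:
  fixes n :: nat
    and A :: "((nat, nat) qpath, 'k::field) balg"
  assumes "n \<ge> 1"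
    and "A = path_algebra (linear_quiver n)"
  shows "\<exists>\<Delta>. \<Delta> \<in> lin_maps (basis A) (basis A \<times> basis A) \<and>
      \<Delta> (triv 1) = seg 1 (n - 1) \<otimes>\<^sub>k triv 1 \<and>
      \<Delta> (triv n) = triv n \<otimes>\<^sub>k seg 1 (n - 1) \<and>
      (\<forall>i\<in>{2..n - 1}. \<Delta> (triv i) = seg i (n - 1) \<otimes>\<^sub>k seg 1 (i - 1)) \<and>
      (\<forall>i j. 1 \<le> i \<and> i \<le> j \<and> j \<le> n - 1 \<longrightarrow>
        \<Delta> (seg i j) = seg i (n - 1) \<otimes>\<^sub>k seg 1 j) \<and>
      nearly_frobenius_space A = maps.span {\<Delta>} \<and>
      Frobdim A = 1"
proof (intro exI[of _ "linear_coproduct n"] conjI)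
  have basis: "basis A = paths (linear_quiver n)"
    by (simp add: assms(2) path_algebra_def)
  have seg: "seg i (j - 1) = (bvec (qp i j) :: _ \<Rightarrow>\<^sub>0 'k)" if "j \<ge> 1" for i j
    using that by (simp add: seg_def)
  have triv: "triv i = (bvec (qp i i) :: _ \<Rightarrow>\<^sub>0 'k)" for i
    by (simp add: triv_def)
  show "linear_coproduct n \<in> lin_maps (basis A) (basis A \<times> basis A)"
    unfolding basis
    by (rule nearly_frobenius_linear_coproduct[unfolded nearly_frobenius_linear_quiver_iff, THEN conjunct1])
  show "linear_coproduct n (triv 1) = seg 1 (n - 1) \<otimes>\<^sub>k (triv 1 :: _ \<Rightarrow>\<^sub>0 'k)"
    unfolding seg[OF assms(1)] triv by (rule linear_coproduct_bvec) (use assms(1) in auto)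
  show "linear_coproduct n (triv n) = (triv n :: _ \<Rightarrow>\<^sub>0 'k) \<otimes>\<^sub>k seg 1 (n - 1)"
    unfolding seg[OF assms(1)] triv by (rule linear_coproduct_bvec) (use assms(1) in auto)
  show "\<forall>i\<in>{2..n - 1}. linear_coproduct n (triv i) = (seg i (n - 1) :: _ \<Rightarrow>\<^sub>0 'k) \<otimes>\<^sub>k seg 1 (i - 1)"
  proof
    fix i assume "i \<in> {2..n - 1}"
    then have i: "1 \<le> i" "i \<le> n" by auto
    show "linear_coproduct n (triv i) = (seg i (n - 1) :: _ \<Rightarrow>\<^sub>0 'k) \<otimes>\<^sub>k seg 1 (i - 1)"
      unfolding seg[OF assms(1)] seg[OF i(1)] triv by (rule linear_coproduct_bvec) (use i in auto)
  qed
  show "\<forall>i j. 1 \<le> i \<and> i \<le> j \<and> j \<le> n - 1 \<longrightarrow>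
      linear_coproduct n (seg i j) = (seg i (n - 1) :: _ \<Rightarrow>\<^sub>0 'k) \<otimes>\<^sub>k seg 1 j"
  proof (intro allI impI)
    fix i j assume ij: "1 \<le> i \<and> i \<le> j \<and> j \<le> n - 1"
    show "linear_coproduct n (seg i j) = (seg i (n - 1) :: _ \<Rightarrow>\<^sub>0 'k) \<otimes>\<^sub>k seg 1 j"
      unfolding seg[OF assms(1)] seg_def[of _ j]
      by (rule linear_coproduct_bvec) (use ij assms(1) in auto)
  qed
  show span: "nearly_frobenius_space A = maps.span {linear_coproduct n}"
    unfolding assms(2) by (rule nearly_frobenius_space_linear_quiver[OF assms(1)])
  have "linear_coproduct n (bvec (qp 1 1)) = (bvec (qp 1 n, qp 1 1) :: _ \<Rightarrow>\<^sub>0 'k)"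
    using assms(1) by (subst linear_coproduct_bvec) auto
  then have "linear_coproduct n (bvec (qp 1 1)) \<noteq> (0 :: _ \<Rightarrow>\<^sub>0 'k)"
    by simp
  then have "linear_coproduct n \<noteq> (0 :: (_ \<Rightarrow>\<^sub>0 'k) \<Rightarrow> _)"
    by (metis zero_fun_apply)
  then have "maps.independent {linear_coproduct n :: (_ \<Rightarrow>\<^sub>0 'k) \<Rightarrow> _}"
    by simp
  then show "Frobdim A = 1"
    unfolding Frobdim_def span maps.dim_span by (simp add: maps.dim_eq_card_independent)
qed

end
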